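(* Let $\mathfrak{g}$ and $\mathfrak{h}$ be vector spaces equipped with bilinear maps $\mu=[~,~]_\mathfrak{g} : \mathfrak{g} \times \mathfrak{g} \to \mathfrak{g}$, $\nu=[~,~]_\mathfrak{h} : \mathfrak{h} \times \mathfrak{h} \to \mathfrak{h}$, $\rho : \mathfrak{g} \times \mathfrak{h} \to \mathfrak{h}$ and $\psi: \mathfrak{h} \times \mathfrak{g} \to \mathfrak{g}$, in which $\mu$ and $\nu$ are skew-symmetric. Define $\mu \ltimes \rho \in C^{1|0}$ and $\psi \rtimes \nu \in C^{0|1}$ by $$(\mu \ltimes \rho) ((x, h) , (y, k)) := ( [x, y]_\mathfrak{g}, \rho_x k - \rho_y h ), \qquad (\psi \rtimes \nu) ((x, h), (y, k)) := ( \psi_h y - \psi_k x , [h, k]_\mathfrak{h} ).$$ Then $( (\mathfrak{g}, \mu), (\mathfrak{h}, \nu), \rho, \psi)$ is a matched pair of Lie algebras if and only if $\pi = ( \mu \ltimes \rho, \psi \rtimes \nu ) \in C^{1|0}\oplus C^{0|1}=\mathcal{M}^1$ is a Maurer-Cartan element of the graded Lie algebra $( \oplus_{n \geq 0} \mathcal{M}^n, [~,~]_\mathrm{NR})$, i.e. $[\pi,\pi]_\mathrm{NR}=0$.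
   Context: All vector spaces and (multi)linear maps are over a field $\mathbf{k}$ of characteristic zero. For a vector space $E$, the Nijenhuis-Richardson bracket of $f\in\mathrm{Hom}(\wedge^{m+1}E,E)$ and $g\in\mathrm{Hom}(\wedge^{n+1}E,E)$ ($m,n\ge 0$) is $[f,g]_\mathrm{NR}=i_f g-(-1)^{mn} i_g f$, where $$(i_f g)(z_1,\ldots,z_{m+n+1})=\sum_{\sigma\in\mathrm{Sh}(m+1,n)}(-1)^\sigma g(f(z_{\sigma(1)},\ldots,z_{\sigma(m+1)}),z_{\sigma(m+2)},\ldots,z_{\sigma(m+n+1)});$$ it makes $\oplus_{n\ge0}\mathrm{Hom}(\wedge^{n+1}E,E)$ a graded Lie algebra with $\mathrm{Hom}(\wedge^{n+1}E,E)$ in degree $n$. Take $E=\mathfrak{g}\oplus\mathfrak{h}$. A map $f\in\mathrm{Hom}(\wedge^{n+1}(\mathfrak{g}\oplus\mathfrak{h}),\mathfrak{g}\oplus\mathfrak{h})$ has bidegree $k|l$ ($k+l=n$, $k,l\ge-1$) if $f(\wedge^{k+1}\mathfrak{g}\otimes\wedge^l\mathfrak{h})\subset\mathfrak{g}$, $f(\wedge^k\mathfrak{g}\otimes\wedge^{l+1}\mathfrak{h})\subset\mathfrak{h}$ and $f=0$ on all other summands $\wedge^a\mathfrak{g}\otimes\wedge^b\mathfrak{h}$ of $\wedge^{n+1}(\mathfrak{g}\oplus\mathfrak{h})$. $C^{k|l}$ is the space of maps of bidegree $k|l$, and $\mathcal{M}^n:=C^{n|0}\oplus C^{n-1|1}\oplus\cdots\oplus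 C^{0|n}$. The space $\oplus_{n\ge0}\mathcal{M}^n$ is a graded Lie subalgebra under $[~,~]_\mathrm{NR}$; $\pi$ is identified with the bilinear map $\mu\ltimes\rho+\psi\rtimes\nu$. $((\mathfrak{g},\mu),(\mathfrak{h},\nu),\rho,\psi)$ is a matched pair of Lie algebras if $(\mathfrak{g},\mu)$ and $(\mathfrak{h},\nu)$ are Lie algebras, $\rho$ is a representation of $\mathfrak{g}$ on $\mathfrak{h}$, $\psi$ is a representation of $\mathfrak{h}$ on $\mathfrak{g}$, and for all $x,y\in\mathfrak{g}$, $h,k\in\mathfrak{h}$: $$\rho_x ([h, k]_\mathfrak{h}) = [\rho_x h , k]_\mathfrak{h} + [h, \rho_x k]_\mathfrak{h} + \rho_{\psi_k x} h - \rho_{\psi_h x} k,$$ $$\psi_h ([x, y]_\mathfrak{g}) = [\psi_h x , y]_\mathfrak{g} + [x, \psi_h y]_\mathfrak{g} + \psi_{\rho_y h} x - \psi_{\rho_x h} y.$$ *)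

theory Defs
  imports "HOL-Analysis.Product_Vector" "HOL-Combinatorics.Permutations"
begin

definition bilinear_map ::
  "('k::field \<Rightarrow> 'a::ab_group_add \<Rightarrow> 'a) \<Rightarrow> ('k \<Rightarrow> 'b::ab_group_add \<Rightarrow> 'b) \<Rightarrow>
   ('k \<Rightarrow> 'c::ab_group_add \<Rightarrow> 'c) \<Rightarrow> ('a \<Rightarrow> 'b \<Rightarrow> 'c) \<Rightarrow> bool" where
  "bilinear_map s1 s2 s3 f \<longleftrightarrow>
     (\<forall>x. Vector_Spaces.linear s2 s3 (f x)) \<and> (\<forall>y. Vector_Spaces.linear s1 s3 (\<lambda>x. f x y))"

definition skew_symmetric :: "('a \<Rightarrow> 'a \<Rightarrow> 'a::ab_group_add) \<Rightarrow> bool" where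
  "skew_symmetric f \<longleftrightarrow> (\<forall>x y. f x y = - f y x)"


section \<open>Alternating maps and the Nijenhuis--Richardson bracket\<close>

text \<open>
  An element of \<open>Hom(\<Lambda>\<^sup>n E, E)\<close> is represented by an alternating \<open>n\<close>-linear map. Its arguments are
  supplied as a sequence \<open>z :: nat \<Rightarrow> 'e\<close>, of which only \<open>z 0, \<dots>, z (n - 1)\<close> matter. By the first
  condition the representing function is unique.
\<close>

definition alt_maps :: "('k::field \<Rightarrow> 'e::ab_group_add \<Rightarrow> 'e) \<Rightarrow> nat \<Rightarrow> ((nat \<Rightarrow> 'e) \<Rightarrow> 'e) set" where
  "alt_maps s n = {f.
     (\<forall>z w. (\<forall>i<n. z i = w i) \<longrightarrow> f z = f w) \<and>
     (\<forall>i<n. \<forall>z. Vector_Spaces.linear s s (\<lambda>x. f (z(i := x)))) \<and>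
     (\<forall>z i j. i < n \<longrightarrow> j < n \<longrightarrow> i \<noteq> j \<longrightarrow> z i = z j \<longrightarrow> f z = 0)}"

text \<open>\<open>(p, q)\<close>-shuffles, acting on the indices \<open>0, \<dots>, p + q - 1\<close>.\<close>

definition Sh :: "nat \<Rightarrow> nat \<Rightarrow> (nat \<Rightarrow> nat) set" where
  "Sh p q = {\<sigma>. \<sigma> permutes {..<p + q} \<and> strict_mono_on {..<p} \<sigma> \<and> strict_mono_on {p..<p + q} \<sigma>}"

text \<open>
  \<open>insertion s m n f g\<close> is \<open>i\<^sub>f g\<close> for \<open>f\<close> of arity \<open>m + 1\<close> and \<open>g\<close> of arity \<open>n + 1\<close>. Since indices
  start at \<open>0\<close>, the argument of \<open>g\<close> at position \<open>j \<ge> 1\<close> is \<open>z (\<sigma> (m + j))\<close>.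
\<close>

definition insertion ::
  "('k::field \<Rightarrow> 'e::ab_group_add \<Rightarrow> 'e) \<Rightarrow> nat \<Rightarrow> nat \<Rightarrow>
   ((nat \<Rightarrow> 'e) \<Rightarrow> 'e) \<Rightarrow> ((nat \<Rightarrow> 'e) \<Rightarrow> 'e) \<Rightarrow> (nat \<Rightarrow> 'e) \<Rightarrow> 'e" where
  "insertion s m n f g z =
     (\<Sum>\<sigma>\<in>Sh (m + 1) n. s (of_int (sign \<sigma>))
        (g (\<lambda>j. if j = 0 then f (\<lambda>i. z (\<sigma> i)) else z (\<sigma> (m + j)))))"

definition NR_bracket ::
  "('k::field \<Rightarrow> 'e::ab_group_add \<Rightarrow> 'e) \<Rightarrow> nat \<Rightarrow> nat \<Rightarrow>
   ((nat \<Rightarrow> 'e) \<Rightarrow> 'e) \<Rightarrow> ((nat \<Rightarrow> 'e) \<Rightarrow> 'e) \<Rightarrow> (nat \<Rightarrow> 'e) \<Rightarrow> 'e" where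
  "NR_bracket s m n f g z =
     insertion s m n f g z - s ((- 1) ^ (m * n)) (insertion s n m g f z)"


section \<open>Bidegrees on \<open>E = \<gg> \<oplus> \<hh>\<close>\<close>

text \<open>
  The \<open>(a + b)\<close>-tuples whose first \<open>a\<close> entries lie in \<open>\<gg>\<close> and whose next \<open>b\<close> entries lie in \<open>\<hh>\<close>;
  their wedge products span \<open>\<Lambda>\<^sup>a\<gg> \<otimes> \<Lambda>\<^sup>b\<hh>\<close>. It is empty for \<open>a < 0\<close> or \<open>b < 0\<close>, when the
  summand is zero.
\<close>

definition summand_tuples :: "int \<Rightarrow> int \<Rightarrow> (nat \<Rightarrow> 'g::zero \<times> 'h::zero) set" where
  "summand_tuples a b = {z. 0 \<le> a \<and> 0 \<le> b \<and>
     (\<forall>i. int i < a \<longrightarrow> snd (z i) = 0) \<and>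
     (\<forall>i. a \<le> int i \<and> int i < a + b \<longrightarrow> fst (z i) = 0)}"

definition bidegree ::
  "('k::field \<Rightarrow> 'g::ab_group_add \<Rightarrow> 'g) \<Rightarrow> ('k \<Rightarrow> 'h::ab_group_add \<Rightarrow> 'h) \<Rightarrow> int \<Rightarrow> int \<Rightarrow>
   ((nat \<Rightarrow> 'g \<times> 'h) \<Rightarrow> 'g \<times> 'h) set" where
  "bidegree sg sh k l = {f \<in> alt_maps (module_prod.scale sg sh) (nat (k + l + 1)).
     - 1 \<le> k \<and> - 1 \<le> l \<and> 0 \<le> k + l \<and>
     (\<forall>z\<in>summand_tuples (k + 1) l. f z \<in> UNIV \<times> {0}) \<and>
     (\<forall>z\<in>summand_tuples k (l + 1). f z \<in> {0} \<times> UNIV) \<and>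
     (\<forall>a b. a + b = k + l + 1 \<and> (a, b) \<noteq> (k + 1, l) \<and> (a, b) \<noteq> (k, l + 1) \<longrightarrow>
        (\<forall>z\<in>summand_tuples a b. f z = 0))}"

text \<open>\<open>\<M>\<^sup>n\<close>, as an internal (direct) sum of spaces of alternating maps.\<close>

definition MM ::
  "('k::field \<Rightarrow> 'g::ab_group_add \<Rightarrow> 'g) \<Rightarrow> ('k \<Rightarrow> 'h::ab_group_add \<Rightarrow> 'h) \<Rightarrow> nat \<Rightarrow>
   ((nat \<Rightarrow> 'g \<times> 'h) \<Rightarrow> 'g \<times> 'h) set" where
  "MM sg sh n = {\<lambda>z. \<Sum>i\<le>n. F i z | F. \<forall>i\<le>n. F i \<in> bidegree sg sh (int i) (int (n - i))}"

definition maurer_cartan ::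
  "('k::field \<Rightarrow> 'g::ab_group_add \<Rightarrow> 'g) \<Rightarrow> ('k \<Rightarrow> 'h::ab_group_add \<Rightarrow> 'h) \<Rightarrow>
   ((nat \<Rightarrow> 'g \<times> 'h) \<Rightarrow> 'g \<times> 'h) \<Rightarrow> bool" where
  "maurer_cartan sg sh p \<longleftrightarrow>
     p \<in> MM sg sh 1 \<and> NR_bracket (module_prod.scale sg sh) 1 1 p p = (\<lambda>z. 0)"

definition semidirect_left ::
  "('g \<Rightarrow> 'g \<Rightarrow> 'g) \<Rightarrow> ('g \<Rightarrow> 'h \<Rightarrow> 'h::ab_group_add) \<Rightarrow> 'g \<times> 'h \<Rightarrow> 'g \<times> 'h \<Rightarrow> 'g \<times> 'h"
  (infixl "\<ltimes>" 70) where
  "(\<mu> \<ltimes> \<rho>) = (\<lambda>(x, h) (y, k). (\<mu> x y, \<rho> x k - \<rho> y h))"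

definition semidirect_right ::
  "('h \<Rightarrow> 'g \<Rightarrow> 'g::ab_group_add) \<Rightarrow> ('h \<Rightarrow> 'h \<Rightarrow> 'h) \<Rightarrow> 'g \<times> 'h \<Rightarrow> 'g \<times> 'h \<Rightarrow> 'g \<times> 'h"
  (infixl "\<rtimes>" 70) where
  "(\<psi> \<rtimes> \<nu>) = (\<lambda>(x, h) (y, k). (\<psi> h y - \<psi> k x, \<nu> h k))"

text \<open>A binary operation in the sequence encoding used by \<^const>\<open>alt_maps\<close>.\<close>

definition binary_cochain :: "('e \<Rightarrow> 'e \<Rightarrow> 'e) \<Rightarrow> (nat \<Rightarrow> 'e) \<Rightarrow> 'e" where
  "binary_cochain B z = B (z 0) (z 1)"


section \<open>Matched pairs of Lie algebras\<close>

definition lie_algebra ::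
  "('k::field \<Rightarrow> 'a::ab_group_add \<Rightarrow> 'a) \<Rightarrow> ('a \<Rightarrow> 'a \<Rightarrow> 'a) \<Rightarrow> bool" where
  "lie_algebra s \<mu> \<longleftrightarrow> vector_space s \<and> bilinear_map s s s \<mu> \<and> skew_symmetric \<mu> \<and>
     (\<forall>x y z. \<mu> (\<mu> x y) z + \<mu> (\<mu> y z) x + \<mu> (\<mu> z x) y = 0)"

definition lie_rep ::
  "('k::field \<Rightarrow> 'a::ab_group_add \<Rightarrow> 'a) \<Rightarrow> ('a \<Rightarrow> 'a \<Rightarrow> 'a) \<Rightarrow>
   ('k \<Rightarrow> 'v::ab_group_add \<Rightarrow> 'v) \<Rightarrow> ('a \<Rightarrow> 'v \<Rightarrow> 'v) \<Rightarrow> bool" where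
  "lie_rep s \<mu> sv \<rho> \<longleftrightarrow> bilinear_map s sv sv \<rho> \<and>
     (\<forall>x y v. \<rho> (\<mu> x y) v = \<rho> x (\<rho> y v) - \<rho> y (\<rho> x v))"

definition matched_pair ::
  "('k::field \<Rightarrow> 'g::ab_group_add \<Rightarrow> 'g) \<Rightarrow> ('k \<Rightarrow> 'h::ab_group_add \<Rightarrow> 'h) \<Rightarrow>
   ('g \<Rightarrow> 'g \<Rightarrow> 'g) \<Rightarrow> ('h \<Rightarrow> 'h \<Rightarrow> 'h) \<Rightarrow> ('g \<Rightarrow> 'h \<Rightarrow> 'h) \<Rightarrow> ('h \<Rightarrow> 'g \<Rightarrow> 'g) \<Rightarrow> bool" where
  "matched_pair sg sh \<mu> \<nu> \<rho> \<psi> \<longleftrightarrow>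
     lie_algebra sg \<mu> \<and> lie_algebra sh \<nu> \<and> lie_rep sg \<mu> sh \<rho> \<and> lie_rep sh \<nu> sg \<psi> \<and>
     (\<forall>x h k. \<rho> x (\<nu> h k) = \<nu> (\<rho> x h) k + \<nu> h (\<rho> x k) + \<rho> (\<psi> k x) h - \<rho> (\<psi> h x) k) \<and>
     (\<forall>h x y. \<psi> h (\<mu> x y) = \<mu> (\<psi> h x) y + \<mu> x (\<psi> h y) + \<psi> (\<rho> y h) x - \<psi> (\<rho> x h) y)"

end

theory Submission
  imports Defs
begin

text \<open>
  For a skew-symmetric bilinear \<open>B\<close>, the bracket \<open>[B, B]\<close> is twice the Jacobiator of \<open>B\<close>, so in
  characteristic zero \<open>B\<close> is Maurer--Cartan iff it satisfies the Jacobi identity. The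
  \<open>\<gg>\<close>-component of the Jacobi identity on \<open>\<gg> \<oplus> \<hh>\<close>, restricted to three, two or one arguments in
  \<open>\<gg>\<close>, is the Jacobi identity of \<open>\<mu>\<close>, the compatibility condition for \<open>\<psi>\<close>, and the representation
  property of \<open>\<psi>\<close>; the \<open>\<hh>\<close>-component is symmetric.
\<close>

section \<open>Bilinear and skew-symmetric maps as alternating cochains\<close>

lemma bilinear_mapI:
  assumes "vector_space s1" "vector_space s2" "vector_space s3"
    and "\<And>x y z. f (x + y) z = f x z + f y z" and "\<And>x y z. f x (y + z) = f x y + f x z"
    and "\<And>c x y. f (s1 c x) y = s3 c (f x y)" and "\<And>c x y. f x (s2 c y) = s3 c (f x y)"
  shows "bilinear_map s1 s2 s3 f"
  using assms unfolding bilinear_map_def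
  by (auto simp: Vector_Spaces.linear_iff)

lemma bilinear_mapD:
  assumes "bilinear_map s1 s2 s3 f"
  shows "f (x + y) z = f x z + f y z" and "f x (u + v) = f x u + f x v"
    and "f (s1 c x) u = s3 c (f x u)" and "f x (s2 c u) = s3 c (f x u)"
    and "f (x - y) z = f x z - f y z" and "f x (u - v) = f x u - f x v"
    and "f (- x) u = - f x u" and "f x (- u) = - f x u"
    and "f 0 u = 0" and "f x 0 = 0"
proof -
  have l: "Vector_Spaces.linear s2 s3 (f x)" "Vector_Spaces.linear s1 s3 (\<lambda>x. f x y)" for x y
    using assms unfolding bilinear_map_def by auto
  then have m: "module_hom s2 s3 (f x)" "module_hom s1 s3 (\<lambda>x. f x y)" for x y
    by (auto simp: module_hom_iff_linear)
  show "f (x + y) z = f x z + f y z" "f x (u + v) = f x u + f x v"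
    "f (s1 c x) u = s3 c (f x u)" "f x (s2 c u) = s3 c (f x u)"
    "f (x - y) z = f x z - f y z" "f x (u - v) = f x u - f x v"
    "f (- x) u = - f x u" "f x (- u) = - f x u" "f 0 u = 0" "f x 0 = 0"
    using module_hom.add[OF m(1)] module_hom.add[OF m(2)]
      module_hom.scale[OF m(1)] module_hom.scale[OF m(2)]
      module_hom.diff[OF m(1)] module_hom.diff[OF m(2)]
      module_hom.neg[OF m(1)] module_hom.neg[OF m(2)]
      module_hom.zero[OF m(1)] module_hom.zero[OF m(2)]
    by auto
qed

text \<open>Characteristic zero enters here: \<open>x + x\<close> is the multiple of
  \<open>x\<close> by 2, and 2 is invertible.\<close>

lemma vector_space_double_eq_0:
  fixes s :: "'k::field_char_0 \<Rightarrow> 'a::ab_group_add \<Rightarrow> 'a"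
    and x :: 'a
  assumes "vector_space s" and "x + x = 0"
  shows "x = 0"
proof -
  interpret vector_space s by fact
  have "s 2 x = 0"
    using assms(2) by (metis one_add_one scale_left_distrib scale_one)
  then show ?thesis by simp
qed

text \<open>Needed because \<open>alt_maps\<close> asks for vanishing on repeated arguments instead
  of a sign change; putting equal arguments into skew-symmetry gives twice the value equal to
  0.\<close>

lemma skew_symmetric_self:
  fixes s :: "'k::field_char_0 \<Rightarrow> 'a::ab_group_add \<Rightarrow> 'a"
    and f :: "'a \<Rightarrow> 'a \<Rightarrow> 'a"
  assumes "vector_space s" and "skew_symmetric f"
  shows "f x x = 0"
  using assms(2) vector_space_double_eq_0[OF assms(1), of "f x x"]
  unfolding skew_symmetric_def by (metis add.left_inverse)

lemma binary_cochain_alt_maps: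
  fixes s :: "'k::field_char_0 \<Rightarrow> 'e::ab_group_add \<Rightarrow> 'e"
  assumes "vector_space s" and B: "bilinear_map s s s B" and skew: "skew_symmetric B"
  shows "binary_cochain B \<in> alt_maps s 2"
proof -
  have l: "Vector_Spaces.linear s s (B x)" "Vector_Spaces.linear s s (\<lambda>x. B x y)" for x y
    using B unfolding bilinear_map_def by auto
  show ?thesis
    using l skew_symmetric_self[OF assms(1) skew]
    by (auto simp: alt_maps_def binary_cochain_def less_2_cases_iff)
qed

section \<open>The two semidirect maps on the direct sum\<close>

lemma vector_space_prod_scale:
  assumes "vector_space sg" and "vector_space sh"
  shows "vector_space (module_prod.scale sg sh)"
proof -
  interpret vector_space_prod sg sh
    using assms by (simp add: vector_space_prod_def vector_space_pair_def)
  show ?thesis by unfold_locales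
qed

lemma module_prod_scale_Pair:
  assumes "vector_space sg" and "vector_space sh"
  shows "module_prod.scale sg sh c (x, h) = (sg c x, sh c h)"
proof -
  interpret vector_space_prod sg sh
    using assms by (simp add: vector_space_prod_def vector_space_pair_def)
  show ?thesis by (simp add: scale_def)
qed

lemma bilinear_map_semidirect_left:
  assumes g: "vector_space sg" and h: "vector_space sh"
    and mu: "bilinear_map sg sg sg \<mu>" and rho: "bilinear_map sg sh sh \<rho>"
  shows "bilinear_map (module_prod.scale sg sh) (module_prod.scale sg sh) (module_prod.scale sg sh)
    (\<mu> \<ltimes> \<rho>)"
proof -
  interpret h: vector_space sh by fact
  show ?thesis
    by (rule bilinear_mapI)
      (auto simp: vector_space_prod_scale[OF g h] module_prod_scale_Pair[OF g h] semidirect_left_def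
        bilinear_mapD[OF mu] bilinear_mapD[OF rho] h.scale_right_diff_distrib)
qed

lemma bilinear_map_semidirect_right:
  assumes g: "vector_space sg" and h: "vector_space sh"
    and nu: "bilinear_map sh sh sh \<nu>" and psi: "bilinear_map sh sg sg \<psi>"
  shows "bilinear_map (module_prod.scale sg sh) (module_prod.scale sg sh) (module_prod.scale sg sh)
    (\<psi> \<rtimes> \<nu>)"
proof -
  interpret g: vector_space sg by fact
  show ?thesis
    by (rule bilinear_mapI)
      (auto simp: vector_space_prod_scale[OF g h] module_prod_scale_Pair[OF g h] semidirect_right_def
        bilinear_mapD[OF nu] bilinear_mapD[OF psi] g.scale_right_diff_distrib)
qed

lemma skew_symmetric_semidirect_left:
  assumes "skew_symmetric \<mu>"
  shows "skew_symmetric (\<mu> \<ltimes> \<rho>)"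
  unfolding skew_symmetric_def
proof (intro allI)
  fix p q
  show "(\<mu> \<ltimes> \<rho>) p q = - (\<mu> \<ltimes> \<rho>) q p"
    using assms[unfolded skew_symmetric_def, rule_format, of "fst p" "fst q"]
    by (simp add: semidirect_left_def split_beta)
qed

lemma skew_symmetric_semidirect_right:
  assumes "skew_symmetric \<nu>"
  shows "skew_symmetric (\<psi> \<rtimes> \<nu>)"
  unfolding skew_symmetric_def
proof (intro allI)
  fix p q
  show "(\<psi> \<rtimes> \<nu>) p q = - (\<psi> \<rtimes> \<nu>) q p"
    using assms[unfolded skew_symmetric_def, rule_format, of "snd p" "snd q"]
    by (simp add: semidirect_right_def split_beta)
qed

section \<open>Bidegrees in arity two\<close>

lemma arity_two_summand_cases:
  fixes a b :: int
  assumes "z \<in> summand_tuples a b" and "a + b = 2"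
  obtains "a = 2" "b = 0" "snd (z 0) = 0" "snd (z 1) = 0"
  | "a = 1" "b = 1" "snd (z 0) = 0" "fst (z 1) = 0"
  | "a = 0" "b = 2" "fst (z 0) = 0" "fst (z 1) = 0"
proof -
  have "a = 2 \<and> b = 0 \<or> a = 1 \<and> b = 1 \<or> a = 0 \<and> b = 2"
    using assms unfolding summand_tuples_def by auto
  then show thesis
    using assms(1) that unfolding summand_tuples_def by force
qed

text \<open>With both arguments in the first summand only \<mu> survives, with one in each only
  \<rho>, and with both in the second every term has a zero argument.\<close>

lemma binary_cochain_semidirect_left_bidegree:
  fixes sg :: "'k::field_char_0 \<Rightarrow> 'g::ab_group_add \<Rightarrow> 'g"
  assumes g: "vector_space sg" and h: "vector_space sh"
    and mu: "bilinear_map sg sg sg \<mu>" and rho: "bilinear_map sg sh sh \<rho>"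
    and "skew_symmetric \<mu>"
  shows "binary_cochain (\<mu> \<ltimes> \<rho>) \<in> bidegree sg sh 1 0"
proof -
  have "binary_cochain (\<mu> \<ltimes> \<rho>) \<in> alt_maps (module_prod.scale sg sh) 2"
    using assms by (intro binary_cochain_alt_maps vector_space_prod_scale
        bilinear_map_semidirect_left skew_symmetric_semidirect_left)
  then show ?thesis
    by (auto simp: bidegree_def binary_cochain_def semidirect_left_def split_beta prod_eq_iff
        bilinear_mapD[OF mu] bilinear_mapD[OF rho] elim!: arity_two_summand_cases)
qed

lemma binary_cochain_semidirect_right_bidegree:
  fixes sg :: "'k::field_char_0 \<Rightarrow> 'g::ab_group_add \<Rightarrow> 'g"
  assumes g: "vector_space sg" and h: "vector_space sh"
    and nu: "bilinear_map sh sh sh \<nu>" and psi: "bilinear_map sh sg sg \<psi>"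
    and "skew_symmetric \<nu>"
  shows "binary_cochain (\<psi> \<rtimes> \<nu>) \<in> bidegree sg sh 0 1"
proof -
  have "binary_cochain (\<psi> \<rtimes> \<nu>) \<in> alt_maps (module_prod.scale sg sh) 2"
    using assms by (intro binary_cochain_alt_maps vector_space_prod_scale
        bilinear_map_semidirect_right skew_symmetric_semidirect_right)
  then show ?thesis
    by (auto simp: bidegree_def binary_cochain_def semidirect_right_def split_beta prod_eq_iff
        bilinear_mapD[OF nu] bilinear_mapD[OF psi] elim!: arity_two_summand_cases)
qed

section \<open>Shuffles and the bracket of a binary cochain\<close>

text \<open>A (2,1)-shuffle is determined by its value at 2, here 2, 1 and 0 in turn. Writing the
  3-cycle as a product of transpositions makes its sign computable.\<close>

lemma Sh_2_1:
  "Sh 2 1 = {id, transpose 1 2, transpose 0 1 \<circ> transpose 1 2}"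
proof (intro set_eqI iffI)
  fix \<sigma> :: "nat \<Rightarrow> nat"
  assume "\<sigma> \<in> Sh 2 1"
  then have p: "\<sigma> permutes {..<3}" and lt: "\<sigma> 0 < \<sigma> 1"
    by (auto simp: Sh_def strict_mono_on_def)
  have outside: "\<sigma> i = i" if "i \<ge> 3" for i
    using permutes_not_in[OF p, of i] that by simp
  have "inj \<sigma>" using p by (rule permutes_inj)
  then have ne: "\<sigma> 2 \<noteq> \<sigma> 0" "\<sigma> 2 \<noteq> \<sigma> 1" by (auto simp: inj_eq)
  have bd: "\<sigma> 0 < 3" "\<sigma> 1 < 3" "\<sigma> 2 < 3"
    using permutes_in_image[OF p] by (auto simp del: One_nat_def)
  \<comment> \<open>Permutations here are functions on all naturals that fix everything from 3 on,
    so three values decide equality.\<close>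
  have eqI: "\<sigma> = \<tau>" if "\<sigma> 0 = \<tau> 0" "\<sigma> 1 = \<tau> 1" "\<sigma> 2 = \<tau> 2" "\<And>i. i \<ge> 3 \<Longrightarrow> \<tau> i = i" for \<tau>
  proof
    fix i :: nat
    consider "i = 0" | "i = 1" | "i = 2" | "i \<ge> 3" by linarith
    then show "\<sigma> i = \<tau> i" using that outside by cases auto
  qed
  consider "\<sigma> 0 = 0" "\<sigma> 1 = 1" "\<sigma> 2 = 2" | "\<sigma> 0 = 0" "\<sigma> 1 = 2" "\<sigma> 2 = 1"
    | "\<sigma> 0 = 1" "\<sigma> 1 = 2" "\<sigma> 2 = 0"
    using lt bd ne by linarith
  then show "\<sigma> \<in> {id, transpose 1 2, transpose 0 1 \<circ> transpose 1 2}"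
  proof cases
    case 1 then have "\<sigma> = id" by (intro eqI) auto
    then show ?thesis by simp
  next
    case 2 then have "\<sigma> = transpose 1 2" by (intro eqI) (auto simp: transpose_def)
    then show ?thesis by simp
  next
    case 3 then have "\<sigma> = transpose 0 1 \<circ> transpose 1 2" by (intro eqI) (auto simp: transpose_def)
    then show ?thesis by simp
  qed
next
  fix \<sigma> :: "nat \<Rightarrow> nat"
  assume "\<sigma> \<in> {id, transpose 1 2, transpose 0 1 \<circ> transpose 1 2}"
  then have "\<sigma> permutes {..<3} \<and> \<sigma> 0 < \<sigma> 1"
    by (elim insertE emptyE) (auto intro!: permutes_id permutes_swap_id permutes_compose
        simp: transpose_def)
  \<comment> \<open>The second block is a singleton, so monotonicity on it is vacuous.\<close>
  moreover have "{2..<3} = {2::nat}" by auto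
  ultimately show "\<sigma> \<in> Sh 2 1"
    by (simp add: Sh_def strict_mono_on_def) (metis less_2_cases less_irrefl not_less_zero)
qed

lemma NR_bracket_binary_cochain:
  fixes s :: "'k::field_char_0 \<Rightarrow> 'e::ab_group_add \<Rightarrow> 'e"
  assumes "vector_space s" and B: "bilinear_map s s s B" and skew: "skew_symmetric B"
  shows "NR_bracket s 1 1 (binary_cochain B) (binary_cochain B) z =
    s 2 (B (B (z 0) (z 1)) (z 2) + B (B (z 1) (z 2)) (z 0) + B (B (z 2) (z 0)) (z 1))"
proof -
  interpret vector_space s by fact
  let ?f = "binary_cochain B"
  \<comment> \<open>Distinctness lets the sum over the explicit set of shuffles split into three
    terms.\<close>
  have ne: "id \<noteq> transpose 1 (2::nat)" "id \<noteq> transpose 0 1 \<circ> transpose 1 (2::nat)"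
    "transpose 1 2 \<noteq> transpose 0 1 \<circ> transpose 1 (2::nat)"
    by (auto simp: fun_eq_iff transpose_def)
  have sgn: "sign (transpose 1 (2::nat)) = -1" "sign (transpose 0 1 \<circ> transpose 1 (2::nat)) = 1"
    by (simp_all add: sign_swap_id sign_compose permutation_swap_id)
  \<comment> \<open>For m = 1 the inner product uses positions 0 and 1 of the shuffle, the outer one
    position 2. The arguments left outside are \<open>z 2\<close>, \<open>z 1\<close>,
    \<open>z 0\<close>, with signs +, -, +.\<close>
  have "insertion s 1 1 ?f ?f z =
      B (B (z 0) (z 1)) (z 2) - B (B (z 0) (z 2)) (z 1) + B (B (z 1) (z 2)) (z 0)"
    using ne by (simp add: insertion_def Sh_2_1[simplified] numeral_2_eq_2[symmetric] sgn[simplified]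
        binary_cochain_def)
  \<comment> \<open>Skew-symmetry of the inner product absorbs the minus sign and makes the sum
    cyclic.\<close>
  moreover have "B (B (z 0) (z 2)) (z 1) = - B (B (z 2) (z 0)) (z 1)"
    using skew bilinear_mapD(7)[OF B] unfolding skew_symmetric_def by metis
  ultimately have i: "insertion s 1 1 ?f ?f z =
      B (B (z 0) (z 1)) (z 2) + B (B (z 1) (z 2)) (z 0) + B (B (z 2) (z 0)) (z 1)"
    by simp
  \<comment> \<open>The bracket sign is \<open>(- 1) ^ (1 * 1)\<close>, so the two insertions add up
    instead of cancelling.\<close>
  have "s 2 x = x - s (-1) x" for x
    using scale_left_distrib[of 1 1 x] by simp
  then show ?thesis
    unfolding NR_bracket_def i by simp
qed

section \<open>Splitting the Jacobi identity into components\<close>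

text \<open>By the symmetry exchanging \<open>\<gg>\<close> and \<open>\<hh>\<close>, this also describes the
  \<open>\<hh>\<close>-component of the Jacobi identity of \<open>\<mu> \<ltimes> \<rho> + \<psi> \<rtimes> \<nu>\<close>.\<close>

lemma jacobi_component_iff:
  fixes \<mu> :: "'g::ab_group_add \<Rightarrow> 'g \<Rightarrow> 'g" and \<nu> :: "'h::ab_group_add \<Rightarrow> 'h \<Rightarrow> 'h"
  assumes mu: "bilinear_map sg sg sg \<mu>" and nu: "bilinear_map sh sh sh \<nu>"
    and rho: "bilinear_map sg sh sh \<rho>" and psi: "bilinear_map sh sg sg \<psi>"
    and skew: "skew_symmetric \<mu>"
  defines "T \<equiv> \<lambda>x h y k w l. \<mu> (\<mu> x y + (\<psi> h y - \<psi> k x)) w +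
    (\<psi> (\<rho> x k - \<rho> y h + \<nu> h k) w - \<psi> l (\<mu> x y + (\<psi> h y - \<psi> k x)))"
  shows "(\<forall>x h y k w l. T x h y k w l + T y k w l x h + T w l x h y k = 0) \<longleftrightarrow>
    (\<forall>x y z. \<mu> (\<mu> x y) z + \<mu> (\<mu> y z) x + \<mu> (\<mu> z x) y = 0) \<and>
    (\<forall>h k x. \<psi> (\<nu> h k) x = \<psi> h (\<psi> k x) - \<psi> k (\<psi> h x)) \<and>
    (\<forall>h x y. \<psi> h (\<mu> x y) = \<mu> (\<psi> h x) y + \<mu> x (\<psi> h y) + \<psi> (\<rho> y h) x - \<psi> (\<rho> x h) y)"
    (is "?J \<longleftrightarrow> ?A \<and> ?B \<and> ?C")
proof
  note D = bilinear_mapD[OF mu] bilinear_mapD[OF nu] bilinear_mapD[OF rho] bilinear_mapD[OF psi]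
  have sk: "\<mu> x y = - \<mu> y x" for x y
    using skew unfolding skew_symmetric_def by blast
  {
    assume J: ?J
    \<comment> \<open>\<open>T\<close> is the first component of the iterated product of
      \<open>(x, h)\<close>, \<open>(y, k)\<close>, then \<open>(w, l)\<close>. Here all three
      arguments are taken in the first summand.\<close>
    have ?A
    proof (intro allI)
      fix x y z
      show "\<mu> (\<mu> x y) z + \<mu> (\<mu> y z) x + \<mu> (\<mu> z x) y = 0"
        using J[rule_format, of x 0 y 0 z 0] by (simp add: T_def D)
    qed
    \<comment> \<open>Two arguments from the second summand, the last from the first.\<close>
    moreover have ?B
    proof (intro allI)
      fix h k x
      show "\<psi> (\<nu> h k) x = \<psi> h (\<psi> k x) - \<psi> k (\<psi> h x)"
        using J[rule_format, of 0 h 0 k x 0] by (simp add: T_def D algebra_simps)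
    qed
    \<comment> \<open>One argument from the second summand, two from the first; \<open>sk\<close>
      moves the \<psi>-image into the right slot of \<mu>.\<close>
    moreover have ?C
    proof (intro allI)
      fix h x y
      show "\<psi> h (\<mu> x y) = \<mu> (\<psi> h x) y + \<mu> x (\<psi> h y) + \<psi> (\<rho> y h) x - \<psi> (\<rho> x h) y"
        using J[rule_format, of 0 h x 0 y 0] sk[of x "\<psi> h y"] by (simp add: T_def D algebra_simps)
    qed
    ultimately show "?A \<and> ?B \<and> ?C" by blast
  }
  assume a: "?A \<and> ?B \<and> ?C"
  show ?J
  proof (intro allI)
    fix x h y k w l
    \<comment> \<open>In \<open>T\<close> the \<psi>-images stand in the left slot of \<mu>, so the
      compatibility condition is brought to that form.\<close>
    have C': "\<psi> h (\<mu> x y) = \<mu> (\<psi> h x) y - \<mu> (\<psi> h y) x + \<psi> (\<rho> y h) x - \<psi> (\<rho> x h) y" for h x y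
      using a sk[of x "\<psi> h y"] by simp
    \<comment> \<open>Stated only for the fixed \<open>x\<close>, \<open>y\<close>,
      \<open>w\<close>: as a general rewrite rule, Jacobi solved for one term would loop.\<close>
    have A: "\<mu> (\<mu> x y) w = - \<mu> (\<mu> y w) x - \<mu> (\<mu> w x) y"
      using a by (metis add_eq_0_iff minus_add_distrib diff_conv_add_uminus add.assoc)
    have B: "\<psi> (\<nu> h k) x = \<psi> h (\<psi> k x) - \<psi> k (\<psi> h x)" for h k x
      using a by blast
    show "T x h y k w l + T y k w l x h + T w l x h y k = 0"
      by (simp add: T_def D C' A B)
  qed
qed

theorem theorem4p3:
  fixes sg :: "'k::field_char_0 \<Rightarrow> 'g::ab_group_add \<Rightarrow> 'g"
    and sh :: "'k \<Rightarrow> 'h::ab_group_add \<Rightarrow> 'h"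
    and \<mu> :: "'g \<Rightarrow> 'g \<Rightarrow> 'g" and \<nu> :: "'h \<Rightarrow> 'h \<Rightarrow> 'h"
    and \<rho> :: "'g \<Rightarrow> 'h \<Rightarrow> 'h" and \<psi> :: "'h \<Rightarrow> 'g \<Rightarrow> 'g"
  assumes "vector_space sg" and "vector_space sh"
    and "bilinear_map sg sg sg \<mu>" and "bilinear_map sh sh sh \<nu>"
    and "bilinear_map sg sh sh \<rho>" and "bilinear_map sh sg sg \<psi>"
    and "skew_symmetric \<mu>" and "skew_symmetric \<nu>"
  shows "binary_cochain (\<mu> \<ltimes> \<rho>) \<in> bidegree sg sh 1 0 \<and>
    binary_cochain (\<psi> \<rtimes> \<nu>) \<in> bidegree sg sh 0 1 \<and>
    (matched_pair sg sh \<mu> \<nu> \<rho> \<psi> \<longleftrightarrow>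
       maurer_cartan sg sh (\<lambda>z. binary_cochain (\<mu> \<ltimes> \<rho>) z + binary_cochain (\<psi> \<rtimes> \<nu>) z))"
proof -
  let ?s = "module_prod.scale sg sh"
  let ?p = "\<lambda>z. binary_cochain (\<mu> \<ltimes> \<rho>) z + binary_cochain (\<psi> \<rtimes> \<nu>) z"
  define B where "B = (\<lambda>u v. (\<mu> \<ltimes> \<rho>) u v + (\<psi> \<rtimes> \<nu>) u v)"
  have left: "binary_cochain (\<mu> \<ltimes> \<rho>) \<in> bidegree sg sh 1 0"
    using assms by (intro binary_cochain_semidirect_left_bidegree)
  have right: "binary_cochain (\<psi> \<rtimes> \<nu>) \<in> bidegree sg sh 0 1"
    using assms by (intro binary_cochain_semidirect_right_bidegree)
  \<comment> \<open>The index in \<open>MM\<close> is the first entry of the bidegree, so index 0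
    selects \<open>\<psi> \<rtimes> \<nu>\<close> and index 1 selects
    \<open>\<mu> \<ltimes> \<rho>\<close>.\<close>
  have MM: "?p \<in> MM sg sh 1"
    unfolding MM_def
    by (rule CollectI, rule exI[of _ "\<lambda>i. if i = 0 then binary_cochain (\<psi> \<rtimes> \<nu>)
        else binary_cochain (\<mu> \<ltimes> \<rho>)"])
      (use left right in \<open>auto simp: le_Suc_eq add.commute\<close>)
  have p: "?p = binary_cochain B"
    by (auto simp: B_def binary_cochain_def)
  interpret E: vector_space ?s
    using assms(1,2) by (rule vector_space_prod_scale)
  have B1: "bilinear_map ?s ?s ?s (\<mu> \<ltimes> \<rho>)" and B2: "bilinear_map ?s ?s ?s (\<psi> \<rtimes> \<nu>)"
    using assms by (auto intro: bilinear_map_semidirect_left bilinear_map_semidirect_right)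
  have "bilinear_map ?s ?s ?s B"
    by (rule bilinear_mapI)
      (auto simp: E.vector_space_axioms B_def bilinear_mapD[OF B1] bilinear_mapD[OF B2]
        E.scale_right_distrib)
  moreover have "skew_symmetric B"
    using skew_symmetric_semidirect_left[OF assms(7), of \<rho>]
      skew_symmetric_semidirect_right[OF assms(8), of \<psi>]
    unfolding skew_symmetric_def B_def by (metis minus_add_distrib)
  ultimately have "NR_bracket ?s 1 1 ?p ?p z = ?s 2
      (B (B (z 0) (z 1)) (z 2) + B (B (z 1) (z 2)) (z 0) + B (B (z 2) (z 0)) (z 1))" for z
    unfolding p by (intro NR_bracket_binary_cochain E.vector_space_axioms)
  \<comment> \<open>The factor 2 cancels by characteristic zero.\<close>
  then have "NR_bracket ?s 1 1 ?p ?p = (\<lambda>z. 0) \<longleftrightarrow>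
      (\<forall>z :: nat \<Rightarrow> _. B (B (z 0) (z 1)) (z 2) + B (B (z 1) (z 2)) (z 0) + B (B (z 2) (z 0)) (z 1) = 0)"
    by (simp add: fun_eq_iff)
  \<comment> \<open>Only three entries of the sequence occur, and every triple extends to a
    sequence.\<close>
  also have "\<dots> \<longleftrightarrow> (\<forall>a b c. B (B a b) c + B (B b c) a + B (B c a) b = 0)"
    (is "?L \<longleftrightarrow> ?R")
  proof
    assume L: ?L
    show ?R
    proof (intro allI)
      fix a b c
      show "B (B a b) c + B (B b c) a + B (B c a) b = 0"
        using L[rule_format, of "\<lambda>i. if i = 0 then a else if i = 1 then b else c"] by simp
    qed
  qed blast
  also have "\<dots> \<longleftrightarrow> matched_pair sg sh \<mu> \<nu> \<rho> \<psi>"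
  proof -
    have component_g: "fst (B (B (x, h) (y, k)) (w, l)) = \<mu> (\<mu> x y + (\<psi> h y - \<psi> k x)) w +
        (\<psi> (\<rho> x k - \<rho> y h + \<nu> h k) w - \<psi> l (\<mu> x y + (\<psi> h y - \<psi> k x)))" for x h y k w l
      by (simp add: B_def semidirect_left_def semidirect_right_def)
    \<comment> \<open>The order of the summands, and of the quantifiers below, makes this the
      formula for \<open>T\<close> with the two summands exchanged, so
      \<open>jacobi_component_iff\<close> applies a second time.\<close>
    have component_h: "snd (B (B (x, h) (y, k)) (w, l)) = \<nu> (\<nu> h k + (\<rho> x k - \<rho> y h)) l +
        (\<rho> (\<psi> h y - \<psi> k x + \<mu> x y) l - \<rho> w (\<nu> h k + (\<rho> x k - \<rho> y h)))" for x h y k w l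
      by (simp add: B_def semidirect_left_def semidirect_right_def add.commute)
    have "?R \<longleftrightarrow>
      (\<forall>x h y k w l. fst (B (B (x, h) (y, k)) (w, l)) + fst (B (B (y, k) (w, l)) (x, h)) +
        fst (B (B (w, l) (x, h)) (y, k)) = 0) \<and>
      (\<forall>h x k y l w. snd (B (B (x, h) (y, k)) (w, l)) + snd (B (B (y, k) (w, l)) (x, h)) +
        snd (B (B (w, l) (x, h)) (y, k)) = 0)"
      unfolding prod_eq_iff split_paired_All by (simp only: fst_add snd_add fst_zero snd_zero) blast
    also have "\<dots> \<longleftrightarrow> matched_pair sg sh \<mu> \<nu> \<rho> \<psi>"
      \<comment> \<open>The two instances yield two Jacobi identities, two representation laws and
        two compatibility conditions; the remaining clauses of \<open>matched_pair\<close> are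
        assumptions.\<close>
      unfolding component_g component_h jacobi_component_iff[OF assms(3-7)]
        jacobi_component_iff[OF assms(4,3,6,5,8)] matched_pair_def lie_algebra_def lie_rep_def
      using assms by blast
    finally show ?thesis .
  qed
  finally show ?thesis
    using left right MM unfolding maurer_cartan_def by blast
qed

end
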